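(* Let $(\tau_t)_{t\ge 0}$ be a norm continuous Markov semigroup on a von Neumann algebra $\mathcal{A}_0$ acting on a separable Hilbert space $\mathcal{H}_0$, with generator $$\mathcal{L}(x)=Y^*x+xY+\sum_{k\ge 1}L_k^*xL_k,\qquad x\in\mathcal{A}_0,$$ where $Y\in\mathcal{A}_0$ is the generator of a norm continuous contractive semigroup on $\mathcal{H}_0$ and $(L_k)_{k\ge 1}$ is a family of bounded operators on $\mathcal{H}_0$ such that $\sum_k L_k^*xL_k\in\mathcal{A}_0$ for all $x\in\mathcal{A}_0$. Put $L_0=Y$. Let $p\in\mathcal{A}_0$ be a sub-harmonic projection for $(\tau_t)$ and $y=\mathrm{s.lim}_{t\to\infty}\tau_t(p)$. Then for any bounded operator $z$ on $\mathcal{H}_0$ the following are equivalent: (a) $yz=0$; (b) $pz=0$ and $pL_{i_1}L_{i_2}\cdots L_{i_n}z=0$ for all $n\ge 1$ and all $0\le i_m<\infty$, $1\le m\le n$.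
   Context: A norm continuous Markov semigroup $(\tau_t)_{t\ge 0}$ on $\mathcal{A}_0$ is a one-parameter semigroup ($t$ ranging over the nonnegative reals) of identity-preserving (unital), normal, completely positive maps on $\mathcal{A}_0$ with $\lim_{t\to 0}\|\tau_t-I\|=0$; its generator is a bounded operator on $\mathcal{A}_0$. A projection $p\in\mathcal{A}_0$ is sub-harmonic if $\tau_t(p)\ge p$ for all $t\ge 0$. For such $p$ the operators $\tau_t(p)$ are increasing in $t$ and bounded by $1$, so the strong limit $y$ exists and $0\le y\le 1$. *)

theory Defs
  imports "HOL-Analysis.Analysis"
begin

section \<open>Complex Hilbert spaces\<close>

text \<open>
  The inner product is linear in the second argument. The underlying real Banach space structure
  supplies the norm topology and the type \<open>'h \<Rightarrow>\<^sub>L 'h\<close> of bounded real-linear operators with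
  the operator norm.
\<close>

class complex_hilbert = banach +
  fixes scaleC :: "complex \<Rightarrow> 'a \<Rightarrow> 'a"
    and cinner :: "'a \<Rightarrow> 'a \<Rightarrow> complex"
  assumes scaleC_add_right: "scaleC c (x + y) = scaleC c x + scaleC c y"
    and scaleC_add_left: "scaleC (c + d) x = scaleC c x + scaleC d x"
    and scaleC_scaleC: "scaleC c (scaleC d x) = scaleC (c * d) x"
    and scaleC_of_real: "scaleC (complex_of_real r) x = r *\<^sub>R x"
    and cinner_commute: "cinner x y = cnj (cinner y x)"
    and cinner_add_right: "cinner x (y + z) = cinner x y + cinner x z"
    and cinner_scaleC_right: "cinner x (scaleC c y) = c * cinner x y"
    and cinner_self: "cinner x x = complex_of_real ((norm x)\<^sup>2)"

lemma norm_scaleC: "norm (scaleC c x) = cmod c * norm (x :: 'h::complex_hilbert)"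
proof -
  have "cinner (scaleC c x) (scaleC c x) = c * (cnj c * cinner x x)"
    by (metis cinner_commute cinner_scaleC_right complex_cnj_mult)
  then have "complex_of_real ((norm (scaleC c x))\<^sup>2) = complex_of_real ((cmod c * norm x)\<^sup>2)"
    by (simp only: cinner_self power_mult_distrib of_real_mult complex_norm_square mult.assoc)
  then have "(norm (scaleC c x))\<^sup>2 = (cmod c * norm x)\<^sup>2"
    by (simp only: of_real_eq_iff)
  then show ?thesis
    by (simp add: power2_eq_iff_nonneg)
qed

lemma bounded_linear_scaleC: "bounded_linear (scaleC c :: 'h \<Rightarrow> 'h::complex_hilbert)"
proof (rule bounded_linear_intro[where K = "cmod c"])
  show "scaleC c (r *\<^sub>R x) = r *\<^sub>R scaleC c x" for r and x :: 'h
    by (simp add: scaleC_scaleC mult.commute flip: scaleC_of_real)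
qed (simp_all add: scaleC_add_right norm_scaleC mult.commute)


section \<open>Bounded operators\<close>

type_synonym 'h op = "'h \<Rightarrow>\<^sub>L 'h"

definition bounded_ops :: "'h::complex_hilbert op set" where
  "bounded_ops = {A. \<forall>c v. blinfun_apply A (scaleC c v) = scaleC c (blinfun_apply A v)}"

definition scaleC_op :: "complex \<Rightarrow> 'h::complex_hilbert op \<Rightarrow> 'h op" where
  "scaleC_op c A = Blinfun (scaleC c) o\<^sub>L A"

lemma scaleC_op_apply: "scaleC_op c A v = scaleC c (A v)"
  by (simp add: scaleC_op_def bounded_linear_Blinfun_apply bounded_linear_scaleC)

text \<open>By the Riesz representation theorem \<open>adj A\<close> is well defined on \<open>bounded_ops\<close>.\<close>

definition adj :: "'h::complex_hilbert op \<Rightarrow> 'h op" where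
  "adj A = (THE B. \<forall>v w. cinner (blinfun_apply A v) w = cinner v (blinfun_apply B w))"

definition positive_op :: "'h::complex_hilbert op \<Rightarrow> bool" where
  "positive_op A \<longleftrightarrow> A \<in> bounded_ops \<and> (\<forall>v. cinner v (A v) \<in> \<real>\<^sub>\<ge>\<^sub>0)"

definition le_op :: "'h::complex_hilbert op \<Rightarrow> 'h op \<Rightarrow> bool" where
  "le_op A B \<longleftrightarrow> positive_op (B - A)"

definition projection_op :: "'h::complex_hilbert op \<Rightarrow> bool" where
  "projection_op P \<longleftrightarrow> P \<in> bounded_ops \<and> P o\<^sub>L P = P \<and> adj P = P"

text \<open>Convergence of a net and of a series of operators in the strong operator topology.\<close>

definition sot_tendsto :: "('i \<Rightarrow> 'h::complex_hilbert op) \<Rightarrow> 'h op \<Rightarrow> 'i filter \<Rightarrow> bool" where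
  "sot_tendsto T A F \<longleftrightarrow> (\<forall>v. ((\<lambda>i. blinfun_apply (T i) v) \<longlongrightarrow> blinfun_apply A v) F)"

definition sot_sums :: "(nat \<Rightarrow> 'h::complex_hilbert op) \<Rightarrow> 'h op \<Rightarrow> bool" where
  "sot_sums T A \<longleftrightarrow> sot_tendsto (\<lambda>n. \<Sum>k<n. T k) A sequentially"

definition sot_summable :: "(nat \<Rightarrow> 'h::complex_hilbert op) \<Rightarrow> bool" where
  "sot_summable T \<longleftrightarrow> (\<exists>A. sot_sums T A)"

definition sot_suminf :: "(nat \<Rightarrow> 'h::complex_hilbert op) \<Rightarrow> 'h op" where
  "sot_suminf T = (THE A. sot_sums T A)"


section \<open>Von Neumann algebras\<close>

definition commutant :: "'h::complex_hilbert op set \<Rightarrow> 'h op set" where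
  "commutant M = {B \<in> bounded_ops. \<forall>A\<in>M. A o\<^sub>L B = B o\<^sub>L A}"

text \<open>
  A self-adjoint set of operators that equals its bicommutant; it is then automatically a unital
  subalgebra, since every commutant is one.
\<close>

definition von_neumann_algebra :: "'h::complex_hilbert op set \<Rightarrow> bool" where
  "von_neumann_algebra M \<longleftrightarrow>
     M \<subseteq> bounded_ops \<and> (\<forall>A\<in>M. adj A \<in> M) \<and> commutant (commutant M) = M"


section \<open>Normal completely positive maps\<close>

text \<open>Maps on an algebra \<open>M\<close> are total functions of which only the restriction to \<open>M\<close> matters.\<close>

definition linear_map_on :: "'h::complex_hilbert op set \<Rightarrow> ('h op \<Rightarrow> 'h op) \<Rightarrow> bool" where
  "linear_map_on M \<phi> \<longleftrightarrow>
     (\<forall>x\<in>M. \<phi> x \<in> M) \<and>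
     (\<forall>x\<in>M. \<forall>y\<in>M. \<phi> (x + y) = \<phi> x + \<phi> y) \<and>
     (\<forall>c. \<forall>x\<in>M. \<phi> (scaleC_op c x) = scaleC_op c (\<phi> x))"

text \<open>
  Positivity of the \<open>n \<times> n\<close> operator matrix \<open>(a i j)\<close>, indices below \<open>n\<close>, acting on the direct sum
  of \<open>n\<close> copies of the Hilbert space.
\<close>

definition positive_op_matrix :: "nat \<Rightarrow> (nat \<Rightarrow> nat \<Rightarrow> 'h::complex_hilbert op) \<Rightarrow> bool" where
  "positive_op_matrix n a \<longleftrightarrow>
     (\<forall>v :: nat \<Rightarrow> 'h. (\<Sum>i<n. \<Sum>j<n. cinner (v i) (a i j (v j))) \<in> \<real>\<^sub>\<ge>\<^sub>0)"

definition completely_positive_on :: "'h::complex_hilbert op set \<Rightarrow> ('h op \<Rightarrow> 'h op) \<Rightarrow> bool" where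
  "completely_positive_on M \<phi> \<longleftrightarrow>
     linear_map_on M \<phi> \<and>
     (\<forall>n a. (\<forall>i<n. \<forall>j<n. a i j \<in> M) \<and> positive_op_matrix n a \<longrightarrow>
        positive_op_matrix n (\<lambda>i j. \<phi> (a i j)))"

definition is_lub_op :: "'h::complex_hilbert op set \<Rightarrow> 'h op set \<Rightarrow> 'h op \<Rightarrow> bool" where
  "is_lub_op M D x \<longleftrightarrow>
     x \<in> M \<and> (\<forall>a\<in>D. le_op a x) \<and> (\<forall>b\<in>M. (\<forall>a\<in>D. le_op a b) \<longrightarrow> le_op x b)"

text \<open>
  Normality of a positive map: it preserves suprema of bounded upward directed families of positive
  elements.
\<close>

definition normal_on :: "'h::complex_hilbert op set \<Rightarrow> ('h op \<Rightarrow> 'h op) \<Rightarrow> bool" where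
  "normal_on M \<phi> \<longleftrightarrow>
     (\<forall>D x. D \<noteq> {} \<and> D \<subseteq> M \<and> (\<forall>a\<in>D. positive_op a) \<and>
        (\<forall>a\<in>D. \<forall>b\<in>D. \<exists>c\<in>D. le_op a c \<and> le_op b c) \<and> is_lub_op M D x \<longrightarrow>
        is_lub_op M (\<phi> ` D) (\<phi> x))"


section \<open>Semigroups and generators\<close>

definition semigroup_on :: "'b set \<Rightarrow> (real \<Rightarrow> 'b \<Rightarrow> 'b) \<Rightarrow> bool" where
  "semigroup_on X T \<longleftrightarrow>
     (\<forall>t\<ge>0. \<forall>x\<in>X. T t x \<in> X) \<and>
     (\<forall>x\<in>X. T 0 x = x) \<and>
     (\<forall>s\<ge>0. \<forall>t\<ge>0. \<forall>x\<in>X. T (s + t) x = T s (T t x))"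

text \<open>
  Operator norm of the restriction of a map to a subspace \<open>X\<close>. Its value is extended real so that
  unbounded maps get norm \<open>\<infinity>\<close>.
\<close>

definition norm_on :: "'b::real_normed_vector set \<Rightarrow> ('b \<Rightarrow> 'b) \<Rightarrow> ennreal" where
  "norm_on X f = (SUP x\<in>{x\<in>X. norm x \<le> 1}. ennreal (norm (f x)))"

definition norm_continuous_on :: "'b::real_normed_vector set \<Rightarrow> (real \<Rightarrow> 'b \<Rightarrow> 'b) \<Rightarrow> bool" where
  "norm_continuous_on X T \<longleftrightarrow> ((\<lambda>t. norm_on X (\<lambda>x. T t x - x)) \<longlongrightarrow> 0) (at_right 0)"

text \<open>\<open>G\<close> is the generator of the semigroup \<open>T\<close>, and is defined on all of \<open>X\<close>.\<close>

definition generator_on ::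
    "'b::real_normed_vector set \<Rightarrow> (real \<Rightarrow> 'b \<Rightarrow> 'b) \<Rightarrow> ('b \<Rightarrow> 'b) \<Rightarrow> bool" where
  "generator_on X T G \<longleftrightarrow> (\<forall>x\<in>X. ((\<lambda>t. (1 / t) *\<^sub>R (T t x - x)) \<longlongrightarrow> G x) (at_right 0))"

definition norm_continuous_markov_semigroup ::
    "'h::complex_hilbert op set \<Rightarrow> (real \<Rightarrow> 'h op \<Rightarrow> 'h op) \<Rightarrow> bool" where
  "norm_continuous_markov_semigroup M \<tau> \<longleftrightarrow>
     semigroup_on M \<tau> \<and>
     (\<forall>t\<ge>0. \<tau> t id_blinfun = id_blinfun \<and> normal_on M (\<tau> t) \<and> completely_positive_on M (\<tau> t)) \<and>
     norm_continuous_on M \<tau>"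

definition norm_continuous_contraction_semigroup :: "(real \<Rightarrow> 'h::complex_hilbert op) \<Rightarrow> bool" where
  "norm_continuous_contraction_semigroup S \<longleftrightarrow>
     (\<forall>t\<ge>0. S t \<in> bounded_ops \<and> norm (S t) \<le> 1) \<and>
     semigroup_on UNIV (\<lambda>t. blinfun_apply (S t)) \<and>
     norm_continuous_on UNIV (\<lambda>t. blinfun_apply (S t))"

definition subharmonic_projection ::
    "'h::complex_hilbert op set \<Rightarrow> (real \<Rightarrow> 'h op \<Rightarrow> 'h op) \<Rightarrow> 'h op \<Rightarrow> bool" where
  "subharmonic_projection M \<tau> p \<longleftrightarrow>
     p \<in> M \<and> projection_op p \<and> (\<forall>t\<ge>0. le_op p (\<tau> t p))"


section \<open>Words in the coefficients\<close>

text \<open>\<open>op_word L [i\<^sub>1, \<dots>, i\<^sub>n]\<close> is the product \<open>L i\<^sub>1 \<cdots> L i\<^sub>n\<close>.\<close>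

definition op_word :: "(nat \<Rightarrow> 'h::complex_hilbert op) \<Rightarrow> nat list \<Rightarrow> 'h op" where
  "op_word L is = foldr (\<lambda>i A. L i o\<^sub>L A) is id_blinfun"

end

theory Submission
  imports Defs
begin

text \<open>
  Since \<open>\<tau> t p\<close> increases to \<open>y\<close> and is positive, \<open>y u = 0\<close> holds iff \<open>\<tau> t p u = 0\<close> for all
  \<open>t \<ge> 0\<close> (\<open>limit_kernel_iff_orbit_kernel\<close>). So the claim, applied to the vectors \<open>u = z v\<close>, is that
  the common kernel \<open>N\<close> of all \<open>\<tau> t p\<close> is the set \<open>V\<close> of all \<open>u\<close> with \<open>p L\<^sub>w u = 0\<close> for every word
  \<open>w\<close>, the empty one included; that is, the largest subspace of the kernel of \<open>p\<close> that is invariant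
  under all \<open>L k\<close> (\<open>orbit_kernel_iff_words\<close>).

  For \<open>N \<subseteq> V\<close> it suffices that \<open>N\<close> is invariant (\<open>orbit_kernel_invariant\<close>). On \<open>N\<close> the derivative of
  \<open>\<tau> t p\<close> vanishes as well. It is the generator applied to \<open>x = \<tau> t p\<close>, and the form of the latter at
  \<open>u \<in> N\<close> is the sum of the nonnegative numbers \<open>\<langle>L\<^sub>k u, x L\<^sub>k u\<rangle>\<close>, \<open>k \<ge> 1\<close>. Hence \<open>x L\<^sub>k u = 0\<close> for
  \<open>k \<ge> 1\<close>, and what remains of the derivative is \<open>x L\<^sub>0 u\<close>.

  For \<open>V \<subseteq> N\<close> consider \<open>\<langle>u, \<tau> t p u\<rangle>\<close> for \<open>u \<in> V\<close>, which is \<open>0\<close> at \<open>t = 0\<close>. As \<open>V\<close> is invariant, its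
  growth rate at time \<open>t\<close> is at most a constant times the supremum of these forms over unit vectors
  in \<open>V\<close> at time \<open>t\<close> (\<open>form_gen_le\<close>), so a Gronwall argument shows that it stays \<open>0\<close>
  (\<open>form_vanishes\<close>). The generator gives derivatives from the right only. They suffice because
  \<open>\<tau> t p\<close> is also continuous from the left, the maps \<open>\<tau> t\<close> being positive and unital
  (\<open>form_increment\<close>, \<open>right_derivative_bound\<close>).
\<close>

section \<open>The inner product\<close>

lemma cinner_add_left: "cinner (x + y) z = cinner x z + cinner y (z :: 'h::complex_hilbert)"
  by (metis cinner_add_right cinner_commute complex_cnj_add)

lemma cinner_scaleC_left: "cinner (scaleC c x) y = cnj c * cinner x (y :: 'h::complex_hilbert)"
  by (metis cinner_commute cinner_scaleC_right complex_cnj_mult)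

lemma cinner_scaleR_right: "cinner x (r *\<^sub>R y) = r *\<^sub>R cinner x (y :: 'h::complex_hilbert)"
  by (metis cinner_scaleC_right scaleC_of_real scaleR_conv_of_real)

lemma cinner_scaleR_left: "cinner (r *\<^sub>R x) y = r *\<^sub>R cinner x (y :: 'h::complex_hilbert)"
  by (metis cinner_scaleC_left scaleC_of_real scaleR_conv_of_real complex_cnj_complex_of_real)

lemma Re_cinner_self: "Re (cinner x x) = (norm (x :: 'h::complex_hilbert))\<^sup>2"
  by (simp add: cinner_self)

lemma Re_cinner_commute: "Re (cinner x y) = Re (cinner y (x :: 'h::complex_hilbert))"
  by (subst cinner_commute) simp

lemma norm_add_square:
  "(norm (x + y))\<^sup>2 = (norm x)\<^sup>2 + (norm y)\<^sup>2 + 2 * Re (cinner x (y :: 'h::complex_hilbert))"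
  using Re_cinner_commute[of x y]
  by (simp add: Re_cinner_self[symmetric] cinner_add_left cinner_add_right)

text \<open>The Cauchy--Schwarz inequality is read off from the triangle inequality here.\<close>

lemma Re_cinner_le: "Re (cinner x y) \<le> norm x * norm (y :: 'h::complex_hilbert)"
proof -
  have "(norm (x + y))\<^sup>2 \<le> (norm x + norm y)\<^sup>2"
    by (intro power_mono norm_triangle_ineq) simp
  then show ?thesis
    by (simp add: norm_add_square power2_sum)
qed

lemma abs_Re_cinner_le: "\<bar>Re (cinner x y)\<bar> \<le> norm x * norm (y :: 'h::complex_hilbert)"
  using Re_cinner_le[of x y] Re_cinner_le[of x "(-1) *\<^sub>R y"]
  by (simp only: cinner_scaleR_right) simp

lemma bounded_bilinear_cinner: "bounded_bilinear (cinner :: 'h::complex_hilbert \<Rightarrow> 'h \<Rightarrow> complex)"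
proof
  show "\<exists>K. \<forall>a b :: 'h. norm (cinner a b) \<le> norm a * norm b * K"
  proof (intro exI[of _ 2] allI)
    fix a b :: 'h
    have "\<bar>Im (cinner a b)\<bar> = \<bar>Re (cinner a (scaleC \<i> b))\<bar>"
      by (simp add: cinner_scaleC_right)
    also have "\<dots> \<le> norm a * norm b"
      using abs_Re_cinner_le[of a "scaleC \<i> b"] by (simp add: norm_scaleC)
    finally show "norm (cinner a b) \<le> norm a * norm b * 2"
      using abs_Re_cinner_le[of a b] cmod_le[of "cinner a b"] by linarith
  qed
qed (simp_all add: cinner_add_left cinner_add_right cinner_scaleR_left cinner_scaleR_right)

interpretation cinner: bounded_bilinear "cinner :: 'h::complex_hilbert \<Rightarrow> 'h \<Rightarrow> complex"
  by (rule bounded_bilinear_cinner)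

declare cinner.zero_left [simp] cinner.zero_right [simp]

lemma eq_zero_if_quadratic_nonneg:
  fixes a b :: real
  assumes "\<And>s. 0 \<le> 2 * s * a + s\<^sup>2 * b"
  shows "a = 0"
proof (rule ccontr)
  assume "a \<noteq> 0"
  \<comment> \<open>Near \<open>0\<close> the linear term dominates, so a small step against its sign is negative.\<close>
  define s where "s = - a / (1 + \<bar>b\<bar>)"
  have "2 * s * a + s\<^sup>2 * b \<le> 2 * s * a + s\<^sup>2 * (1 + \<bar>b\<bar>)"
    by (intro add_left_mono mult_left_mono) auto
  also have "s\<^sup>2 * (1 + \<bar>b\<bar>) = - s * a"
    by (simp add: s_def power2_eq_square)
  also have "2 * s * a + - s * a = - (a\<^sup>2 / (1 + \<bar>b\<bar>))"
    by (simp add: s_def power2_eq_square)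
  also have "\<dots> < 0"
    using \<open>a \<noteq> 0\<close> by (simp add: add_pos_nonneg)
  finally show False using assms[of s] by simp
qed

text \<open>
  Riesz representation: the minimiser \<open>w\<close> of \<open>\<parallel>w\<parallel>\<^sup>2 - 2 f w\<close> represents \<open>f\<close>, because the first
  variation of this functional in the direction \<open>v\<close> is \<open>2 (Re \<langle>w, v\<rangle> - f v)\<close>. A minimiser exists
  because, by the parallelogram law, minimising sequences are Cauchy.
\<close>

lemma riesz_representation:
  fixes f :: "'h::complex_hilbert \<Rightarrow> real"
  assumes f: "bounded_linear f"
  shows "\<exists>w. \<forall>v. f v = Re (cinner w v)"
proof -
  interpret f: bounded_linear f by (rule f)
  obtain K where K: "\<And>x. norm (f x) \<le> norm x * K"
    using f.bounded by blast
  define J where "J w = (norm w)\<^sup>2 - 2 * f w" for w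
  have J_ge: "- K\<^sup>2 \<le> J w" for w
  proof -
    have "f w \<le> norm w * K" using K[of w] by (simp add: abs_le_iff)
    moreover have "0 \<le> (norm w - K)\<^sup>2" by simp
    ultimately show ?thesis unfolding J_def power2_diff by linarith
  qed
  define m where "m = Inf (range J)"
  have bdd: "bdd_below (range J)" using J_ge by (auto intro!: bdd_belowI)
  have m_le: "m \<le> J w" for w unfolding m_def by (rule cInf_lower[OF _ bdd]) auto
  have "\<exists>w. J w < m + inverse (real (Suc n))" for n
  proof -
    have "\<exists>j\<in>range J. j < m + inverse (real (Suc n))"
      using cInf_less_iff[of "range J" "m + inverse (real (Suc n))"] bdd
      by (simp add: m_def del: of_nat_Suc)
    then show ?thesis by blast
  qed
  then obtain w where w: "\<And>n. J (w n) < m + inverse (real (Suc n))" by metis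
  have close: "(norm (a - b))\<^sup>2 \<le> 2 * (J a - m) + 2 * (J b - m)" for a b
  proof -
    have "m \<le> J ((1/2) *\<^sub>R (a + b))" by (rule m_le)
    also have "\<dots> = (norm (a + b))\<^sup>2 / 4 - (f a + f b)"
      unfolding J_def by (simp only: f.scaleR f.add norm_scaleR) (simp add: power_divide field_simps)
    finally show ?thesis
      using norm_add_square[of a b] norm_add_square[of a "-b"]
      by (simp add: J_def cinner.minus_right field_simps)
  qed
  have "Cauchy w"
  proof (rule CauchyI)
    fix e :: real assume e: "e > 0"
    obtain N where N: "inverse (real (Suc N)) < e\<^sup>2 / 4"
      using reals_Archimedean[of "e\<^sup>2 / 4"] e by auto
    have small: "J (w n) - m < e\<^sup>2 / 4" if "n \<ge> N" for n
    proof -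
      have "inverse (real (Suc n)) \<le> inverse (real (Suc N))"
        using that by (intro le_imp_inverse_le) auto
      then show ?thesis using w[of n] N by linarith
    qed
    have "norm (w i - w j) < e" if "i \<ge> N" "j \<ge> N" for i j
    proof -
      have "(norm (w i - w j))\<^sup>2 < e\<^sup>2"
        using close[of "w i" "w j"] small[OF that(1)] small[OF that(2)] by (simp add: field_simps)
      then show ?thesis using e by (simp add: power2_less_imp_less)
    qed
    then show "\<exists>N. \<forall>i\<ge>N. \<forall>j\<ge>N. norm (w i - w j) < e" by blast
  qed
  then obtain w0 where w0: "w \<longlonglongrightarrow> w0" using Cauchy_convergent convergent_def by blast
  have "(\<lambda>n. J (w n)) \<longlonglongrightarrow> J w0"
    unfolding J_def by (intro tendsto_intros w0 f.tendsto)
  moreover have "(\<lambda>n. m + inverse (real (Suc n))) \<longlonglongrightarrow> m + 0"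
    by (intro tendsto_intros LIMSEQ_inverse_real_of_nat)
  ultimately have "J w0 \<le> m + 0"
    using w by (intro LIMSEQ_le) (auto intro!: exI[of _ 0] less_imp_le)
  then have min: "J w0 \<le> J v" for v using m_le[of v] by simp
  have "f v = Re (cinner w0 v)" for v
  proof -
    have "0 \<le> 2 * s * (Re (cinner w0 v) - f v) + s\<^sup>2 * (norm v)\<^sup>2" for s
    proof -
      have "J (w0 + s *\<^sub>R v)
          = J w0 + 2 * s * (Re (cinner w0 v) - f v) + s\<^sup>2 * (norm v)\<^sup>2"
        unfolding J_def norm_add_square
        by (simp add: f.add f.scaleR cinner_scaleR_right power_mult_distrib algebra_simps)
      then show ?thesis using min[of "w0 + s *\<^sub>R v"] by linarith
    qed
    then have "Re (cinner w0 v) - f v = 0" by (rule eq_zero_if_quadratic_nonneg)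
    then show ?thesis by simp
  qed
  then show ?thesis by blast
qed

lemma eq_if_Re_cinner_eq:
  assumes "\<And>v. Re (cinner v a) = Re (cinner v (b :: 'h::complex_hilbert))"
  shows "a = b"
proof -
  have "Re (cinner (a - b) (a - b)) = 0"
    using assms[of "a - b"] by (simp add: cinner.diff_right)
  then show ?thesis by (simp add: Re_cinner_self)
qed


section \<open>Adjoints and positive operators\<close>

lemma bounded_opsD: "A \<in> bounded_ops \<Longrightarrow> blinfun_apply A (scaleC c v) = scaleC c (blinfun_apply A v)"
  by (simp add: bounded_ops_def)

lemma adjoint_exists:
  fixes A :: "'h::complex_hilbert op"
  assumes A: "A \<in> bounded_ops"
  shows "\<exists>B. \<forall>v w. cinner (blinfun_apply A v) w = cinner v (blinfun_apply B w)"
proof -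
  have "\<exists>b. \<forall>v. Re (cinner w (blinfun_apply A v)) = Re (cinner b v)" for w
    by (rule riesz_representation)
      (intro bounded_linear_compose[OF bounded_linear_Re]
        bounded_linear_compose[OF cinner.bounded_linear_right] blinfun.bounded_linear_right)
  then obtain b where b: "\<And>w v. Re (cinner w (blinfun_apply A v)) = Re (cinner (b w) v)"
    by metis
  have b': "Re (cinner v (b w)) = Re (cinner (blinfun_apply A v) w)" for v w
    by (metis b Re_cinner_commute)
  have bl: "bounded_linear b"
  proof (rule bounded_linear_intro[where K = "norm A"])
    show "b (x + y) = b x + b y" for x y
      by (rule eq_if_Re_cinner_eq) (simp add: b' cinner_add_right)
    show "b (r *\<^sub>R x) = r *\<^sub>R b x" for r x
      by (rule eq_if_Re_cinner_eq) (simp add: b' cinner_scaleR_right)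
    show "norm (b x) \<le> norm x * norm A" for x
    proof -
      have "norm (b x) * norm (b x) = Re (cinner (blinfun_apply A (b x)) x)"
        using b'[of "b x" x] by (simp add: Re_cinner_self power2_eq_square)
      also have "\<dots> \<le> norm (blinfun_apply A (b x)) * norm x" by (rule Re_cinner_le)
      also have "\<dots> \<le> norm A * norm (b x) * norm x"
        by (intro mult_right_mono norm_blinfun) simp
      finally have "norm (b x) * norm (b x) \<le> (norm x * norm A) * norm (b x)"
        by (simp add: ac_simps)
      then show ?thesis
        by (cases "b x = 0") auto
    qed
  qed
  have "cinner (blinfun_apply A v) w = cinner v (blinfun_apply (Blinfun b) w)" for v w
  proof (rule complex_eqI)
    show "Re (cinner (blinfun_apply A v) w) = Re (cinner v (blinfun_apply (Blinfun b) w))"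
      by (simp add: bounded_linear_Blinfun_apply[OF bl] b')
    \<comment> \<open>Complex linearity turns the identity of real parts at \<open>\<i> v\<close> into that of imaginary parts at \<open>v\<close>.\<close>
    show "Im (cinner (blinfun_apply A v) w) = Im (cinner v (blinfun_apply (Blinfun b) w))"
      using b'[of "scaleC \<i> v" w]
      by (simp add: bounded_linear_Blinfun_apply[OF bl] bounded_opsD[OF A] cinner_scaleC_left)
  qed
  then show ?thesis by blast
qed

lemma cinner_adj:
  fixes A :: "'h::complex_hilbert op"
  assumes "A \<in> bounded_ops"
  shows "cinner v (blinfun_apply (adj A) w) = cinner (blinfun_apply A v) w"
proof -
  have "\<exists>!B. \<forall>v w. cinner (blinfun_apply A v) w = cinner v (blinfun_apply B w)"
  proof (rule ex_ex1I[OF adjoint_exists[OF assms]])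
    fix B C
    assume "\<forall>v w. cinner (blinfun_apply A v) w = cinner v (blinfun_apply B w)"
      "\<forall>v w. cinner (blinfun_apply A v) w = cinner v (blinfun_apply C w)"
    then show "B = C"
      by (intro blinfun_eqI eq_if_Re_cinner_eq) metis
  qed
  from theI'[OF this] show ?thesis unfolding adj_def by metis
qed

lemma positive_op_Re: "positive_op A \<Longrightarrow> 0 \<le> Re (cinner v (blinfun_apply A v))"
  by (auto simp: positive_op_def complex_nonneg_Reals_iff)

text \<open>
  A form that is real on the diagonal is Hermitian, by polarisation. This holds only over the
  complex scalars, hence the appeal to \<open>\<i> w\<close>.
\<close>

lemma positive_op_Re_sym:
  assumes A: "positive_op A"
  shows "Re (cinner v (blinfun_apply A w)) = Re (cinner w (blinfun_apply A v))"
proof -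
  have b: "A \<in> bounded_ops" and im: "\<And>u. Im (cinner u (blinfun_apply A u)) = 0"
    using A by (auto simp: positive_op_def complex_nonneg_Reals_iff)
  show ?thesis
    using im[of "v + scaleC \<i> w"] im[of v] im[of w]
    by (simp add: blinfun.add_right cinner_add_left cinner_add_right bounded_opsD[OF b]
        cinner_scaleC_left cinner_scaleC_right)
qed

lemma positive_op_form_add:
  assumes A: "positive_op A"
  shows "Re (cinner (v + s *\<^sub>R w) (blinfun_apply A (v + s *\<^sub>R w)))
    = Re (cinner v (blinfun_apply A v)) + 2 * s * Re (cinner w (blinfun_apply A v))
      + s\<^sup>2 * Re (cinner w (blinfun_apply A w))"
  using positive_op_Re_sym[OF A, of v w]
  by (simp add: blinfun.add_right blinfun.scaleR_right cinner_add_left cinner_add_right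
      cinner_scaleR_left cinner_scaleR_right power2_eq_square algebra_simps)

text \<open>A positive form vanishing at \<open>v\<close> is minimal there, so its first variation vanishes too.\<close>

lemma positive_op_kernel:
  assumes A: "positive_op A" and 0: "Re (cinner v (blinfun_apply A v)) = 0"
  shows "blinfun_apply A v = 0"
proof -
  have "Re (cinner (blinfun_apply A v) (blinfun_apply A v)) = 0"
  proof (rule eq_zero_if_quadratic_nonneg)
    let ?w = "blinfun_apply A v"
    show "0 \<le> 2 * s * Re (cinner ?w ?w) + s\<^sup>2 * Re (cinner ?w (blinfun_apply A ?w))" for s
      using positive_op_Re[OF A, of "v + s *\<^sub>R ?w"] positive_op_form_add[OF A, of v s ?w] 0
      by simp
  qed
  then show ?thesis by (simp add: Re_cinner_self)
qed

lemma Re_form_le_norm: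
  "Re (cinner v (blinfun_apply A v)) \<le> norm A * (norm (v :: 'h::complex_hilbert))\<^sup>2"
proof -
  have "Re (cinner v (blinfun_apply A v)) \<le> norm v * (norm A * norm v)"
    by (meson Re_cinner_le norm_blinfun mult_left_mono norm_ge_zero order_trans)
  then show ?thesis by (simp add: power2_eq_square ac_simps)
qed

lemma positive_op_projection:
  assumes "projection_op P"
  shows "positive_op P"
proof -
  have P: "P \<in> bounded_ops" "P o\<^sub>L P = P" "adj P = P"
    using assms by (auto simp: projection_op_def)
  have "cinner v (blinfun_apply P v) = cinner (blinfun_apply P v) (blinfun_apply P v)" for v
    using cinner_adj[OF P(1), of v "blinfun_apply P v"] P(2,3)
    by (metis blinfun_apply_blinfun_compose)
  then show ?thesis
    using P(1) by (simp add: positive_op_def cinner_self)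
qed


section \<open>Positive maps on a von Neumann algebra\<close>

lemma bounded_ops_lincomb:
  assumes "A \<in> bounded_ops" "B \<in> bounded_ops"
  shows "A + B \<in> bounded_ops" "scaleC_op c A \<in> bounded_ops" "id_blinfun \<in> bounded_ops"
  using assms
  by (auto simp: bounded_ops_def blinfun.add_left scaleC_add_right scaleC_op_apply scaleC_scaleC
      mult.commute)

lemma commutant_lincomb:
  assumes A: "A \<in> commutant M" and B: "B \<in> commutant M" and M: "M \<subseteq> bounded_ops"
  shows "A + B \<in> commutant M" "scaleC_op c A \<in> commutant M" "id_blinfun \<in> commutant M"
proof -
  have comm: "blinfun_apply T (blinfun_apply X v) = blinfun_apply X (blinfun_apply T v)"
    if "T \<in> M" "X \<in> commutant M" for T X v
    using that by (metis (mono_tags, lifting) blinfun_apply_blinfun_compose commutant_def mem_Collect_eq)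
  have "A \<in> bounded_ops" "B \<in> bounded_ops"
    using A B by (auto simp: commutant_def)
  note b = bounded_ops_lincomb[OF this]
  show "A + B \<in> commutant M" "scaleC_op c A \<in> commutant M" "id_blinfun \<in> commutant M"
    using b M by (auto simp: commutant_def scaleC_op_apply subset_iff bounded_opsD
        blinfun.add_left blinfun.add_right comm[OF _ A] comm[OF _ B] intro!: blinfun_eqI)
qed

lemma scaleC_op_of_real: "scaleC_op (complex_of_real r) A = r *\<^sub>R A"
  by (rule blinfun_eqI) (simp add: scaleC_op_apply scaleC_of_real blinfun.scaleR_left)

lemma von_neumann_algebra_closed:
  assumes M: "von_neumann_algebra M"
  shows "A \<in> M \<Longrightarrow> B \<in> M \<Longrightarrow> A + B \<in> M"
    and "A \<in> M \<Longrightarrow> r *\<^sub>R A \<in> M"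
    and "A \<in> M \<Longrightarrow> B \<in> M \<Longrightarrow> A - B \<in> M"
    and "A \<in> M \<Longrightarrow> id_blinfun \<in> M"
proof -
  have M': "commutant M \<subseteq> bounded_ops" "commutant (commutant M) = M"
    using M by (auto simp: von_neumann_algebra_def commutant_def)
  show add: "A \<in> M \<Longrightarrow> B \<in> M \<Longrightarrow> A + B \<in> M" for A B
    using commutant_lincomb(1)[of A "commutant M" B] M' by simp
  show scale: "A \<in> M \<Longrightarrow> r *\<^sub>R A \<in> M" for A r
    using commutant_lincomb(2)[of A "commutant M" A "complex_of_real r"] M'
    by (simp add: scaleC_op_of_real)
  show "A \<in> M \<Longrightarrow> B \<in> M \<Longrightarrow> A - B \<in> M"
    using add[of A "(-1) *\<^sub>R B"] scale[of B "-1"] by simp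
  show "A \<in> M \<Longrightarrow> id_blinfun \<in> M"
    using commutant_lincomb(3)[of A "commutant M" A] M' by simp
qed

lemma linear_map_on_real:
  assumes M: "von_neumann_algebra M" and \<phi>: "linear_map_on M \<phi>"
  shows "x \<in> M \<Longrightarrow> \<phi> (r *\<^sub>R x) = r *\<^sub>R \<phi> x"
    and "x \<in> M \<Longrightarrow> y \<in> M \<Longrightarrow> \<phi> (x - y) = \<phi> x - \<phi> y"
proof -
  show scale: "\<phi> (r *\<^sub>R x) = r *\<^sub>R \<phi> x" if "x \<in> M" for r x
    using \<phi> that by (metis linear_map_on_def scaleC_op_of_real)
  assume x: "x \<in> M" and y: "y \<in> M"
  have "\<phi> (x + (-1) *\<^sub>R y) = \<phi> x + \<phi> ((-1) *\<^sub>R y)"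
    using \<phi> x von_neumann_algebra_closed(2)[OF M y] unfolding linear_map_on_def by blast
  then show "\<phi> (x - y) = \<phi> x - \<phi> y" using scale[OF y, of "-1"] by simp
qed

lemma completely_positive_on_positive:
  assumes \<phi>: "completely_positive_on M \<phi>" and M: "M \<subseteq> bounded_ops" and x: "x \<in> M" "positive_op x"
  shows "positive_op (\<phi> x)"
proof -
  have "positive_op_matrix 1 (\<lambda>i j. x)"
    using x(2) by (simp add: positive_op_matrix_def positive_op_def)
  then have "positive_op_matrix 1 (\<lambda>i j. \<phi> x)"
    using \<phi> x(1) unfolding completely_positive_on_def
    by (auto dest!: spec[of _ "1::nat"] spec[of _ "\<lambda>i j. x"])
  then have "cinner v (blinfun_apply (\<phi> x) v) \<in> \<real>\<^sub>\<ge>\<^sub>0" for v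
    by (auto simp: positive_op_matrix_def dest: spec[of _ "\<lambda>_. v"])
  moreover have "\<phi> x \<in> M"
    using \<phi> x(1) by (simp add: completely_positive_on_def linear_map_on_def)
  ultimately show ?thesis using M by (auto simp: positive_op_def)
qed


section \<open>A mean value inequality for right derivatives\<close>

text \<open>
  For \<open>e > 0\<close> the set of \<open>t\<close> with \<open>f t - f a \<le> (K + e) (t - a)\<close> is closed, and by the bound on the
  right derivative no point left of \<open>b\<close> is its greatest element.
\<close>

lemma right_derivative_bound:
  fixes f :: "real \<Rightarrow> real"
  assumes ab: "a \<le> b" and cont: "continuous_on {a..b} f"
    and deriv: "\<And>t. a \<le> t \<Longrightarrow> t < b \<Longrightarrow> ((\<lambda>h. (f (t + h) - f t) / h) \<longlongrightarrow> D t) (at_right 0)"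
    and D: "\<And>t. a \<le> t \<Longrightarrow> t < b \<Longrightarrow> D t \<le> K"
  shows "f b - f a \<le> K * (b - a)"
proof -
  have *: "f b - f a \<le> (K + e) * (b - a)" if e: "e > 0" for e
  proof -
    define S where "S = {t \<in> {a..b}. f t - f a \<le> (K + e) * (t - a)}"
    have "closed S"
      unfolding S_def by (intro continuous_on_closed_Collect_le continuous_intros cont)
    moreover have "a \<in> S" "bdd_above S"
      using ab by (auto simp: S_def intro!: bdd_aboveI[of _ b])
    ultimately have s: "Sup S \<in> S" by (intro closed_contains_Sup; auto)
    define s where "s = Sup S"
    have s_in: "a \<le> s" "s \<le> b" "f s - f a \<le> (K + e) * (s - a)"
      using s by (auto simp: S_def s_def)
    have "s = b"
    proof (rule ccontr)
      assume "s \<noteq> b"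
      then have sb: "s < b" using s_in by simp
      have "D s < K + e" using D[OF s_in(1) sb] e by simp
      then have "eventually (\<lambda>h. (f (s + h) - f s) / h < K + e) (at_right 0)"
        using deriv[OF s_in(1) sb] by (rule order_tendstoD(2)[rotated])
      moreover have "eventually (\<lambda>h. 0 < h \<and> h < b - s) (at_right 0)"
        using sb by (auto simp: eventually_at_right[of 0 1] intro!: exI[of _ "b - s"])
      ultimately have "eventually (\<lambda>h. (f (s + h) - f s) / h < K + e \<and> 0 < h \<and> h < b - s) (at_right 0)"
        by eventually_elim simp
      then obtain h where h: "(f (s + h) - f s) / h < K + e" "0 < h" "h < b - s"
        using eventually_happens'[of "at_right (0::real)"] trivial_limit_at_right_real by blast
      then have "f (s + h) - f s \<le> (K + e) * h" by (simp add: field_simps)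
      then have "s + h \<in> S"
        using s_in h by (simp add: S_def algebra_simps)
      then have "s + h \<le> s"
        unfolding s_def by (rule cSup_upper) (use \<open>bdd_above S\<close> in simp)
      then show False using h by simp
    qed
    then show ?thesis using s_in by simp
  qed
  show ?thesis
  proof (cases "a = b")
    case False
    then have ab': "b - a > 0" using ab by simp
    show ?thesis
    proof (rule field_le_epsilon)
      fix e :: real assume "e > 0"
      then have "f b - f a \<le> (K + e / (b - a)) * (b - a)"
        using ab' by (intro *) simp
      also have "\<dots> = K * (b - a) + e" using ab' by (simp add: distrib_right)
      finally show "f b - f a \<le> K * (b - a) + e" .
    qed
  qed simp
qed


section \<open>The orbit of a sub-harmonic projection\<close>

text \<open>
  \<open>\<Phi>\<close> is the completely positive part of the generator, and \<open>L 0\<close> its drift, so that words may use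
  all \<open>L k\<close> on the same footing.
\<close>

locale lindblad_semigroup =
  fixes M :: "'h::complex_hilbert op set"
    and \<tau> :: "real \<Rightarrow> 'h op \<Rightarrow> 'h op"
    and L :: "nat \<Rightarrow> 'h op"
    and \<Phi> :: "'h op \<Rightarrow> 'h op"
    and p :: "'h op"
  assumes vN: "von_neumann_algebra M"
    and markov: "norm_continuous_markov_semigroup M \<tau>"
    and L_bounded: "L k \<in> bounded_ops"
    and \<Phi>_sums: "x \<in> M \<Longrightarrow> sot_sums (\<lambda>k. adj (L (Suc k)) o\<^sub>L x o\<^sub>L L (Suc k)) (\<Phi> x)"
    and generator: "generator_on M \<tau> (\<lambda>x. (adj (L 0) o\<^sub>L x) + (x o\<^sub>L L 0) + \<Phi> x)"
    and p: "subharmonic_projection M \<tau> p"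
begin

lemma M_bounded: "M \<subseteq> bounded_ops"
  using vN by (simp add: von_neumann_algebra_def)

lemma p_in: "p \<in> M" and p_proj: "projection_op p" and p_le: "t \<ge> 0 \<Longrightarrow> positive_op (\<tau> t p - p)"
  using p by (auto simp: subharmonic_projection_def le_op_def)

lemma \<tau>_in: "t \<ge> 0 \<Longrightarrow> x \<in> M \<Longrightarrow> \<tau> t x \<in> M"
  and \<tau>_0: "x \<in> M \<Longrightarrow> \<tau> 0 x = x"
  and \<tau>_add: "s \<ge> 0 \<Longrightarrow> t \<ge> 0 \<Longrightarrow> x \<in> M \<Longrightarrow> \<tau> (s + t) x = \<tau> s (\<tau> t x)"
  and \<tau>_id: "t \<ge> 0 \<Longrightarrow> \<tau> t id_blinfun = id_blinfun"
  and \<tau>_cp: "t \<ge> 0 \<Longrightarrow> completely_positive_on M (\<tau> t)"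
  and \<tau>_lin: "t \<ge> 0 \<Longrightarrow> linear_map_on M (\<tau> t)"
  using markov
  by (auto simp: norm_continuous_markov_semigroup_def semigroup_on_def completely_positive_on_def)

lemma \<tau>_positive: "t \<ge> 0 \<Longrightarrow> x \<in> M \<Longrightarrow> positive_op x \<Longrightarrow> positive_op (\<tau> t x)"
  by (rule completely_positive_on_positive[OF \<tau>_cp M_bounded])

lemma id_in: "id_blinfun \<in> M"
  using von_neumann_algebra_closed(4)[OF vN p_in] .

lemma \<tau>_p_in: "t \<ge> 0 \<Longrightarrow> \<tau> t p \<in> M"
  by (rule \<tau>_in[OF _ p_in])

lemma \<tau>_p_positive: "t \<ge> 0 \<Longrightarrow> positive_op (\<tau> t p)"
  by (rule \<tau>_positive[OF _ p_in positive_op_projection[OF p_proj]])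

lemma form_sums:
  assumes "x \<in> M"
  shows "(\<lambda>k. Re (cinner (blinfun_apply (L (Suc k)) u) (blinfun_apply x (blinfun_apply (L (Suc k)) u))))
    sums Re (cinner u (blinfun_apply (\<Phi> x) u))"
proof -
  have "(\<lambda>n. blinfun_apply (\<Sum>k<n. adj (L (Suc k)) o\<^sub>L x o\<^sub>L L (Suc k)) u)
      \<longlonglongrightarrow> blinfun_apply (\<Phi> x) u"
    using \<Phi>_sums[OF assms] by (simp add: sot_sums_def sot_tendsto_def)
  then have "(\<lambda>n. Re (cinner u (blinfun_apply (\<Sum>k<n. adj (L (Suc k)) o\<^sub>L x o\<^sub>L L (Suc k)) u)))
      \<longlonglongrightarrow> Re (cinner u (blinfun_apply (\<Phi> x) u))"
    by (intro tendsto_Re cinner.tendsto tendsto_const)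
  then show ?thesis
    by (simp add: sums_def blinfun.sum_left cinner.sum_right cinner_adj[OF L_bounded])
qed

abbreviation (input) gen :: "'h op \<Rightarrow> 'h op" where
  "gen x \<equiv> (adj (L 0) o\<^sub>L x) + (x o\<^sub>L L 0) + \<Phi> x"

lemma form_gen:
  "Re (cinner u (blinfun_apply (gen x) u))
    = Re (cinner (blinfun_apply (L 0) u) (blinfun_apply x u))
      + Re (cinner u (blinfun_apply x (blinfun_apply (L 0) u)))
      + Re (cinner u (blinfun_apply (\<Phi> x) u))"
  by (simp add: blinfun.add_left cinner_add_right cinner_adj[OF L_bounded])

lemma \<tau>_right_derivative:
  assumes "t \<ge> 0"
  shows "((\<lambda>h. (1 / h) *\<^sub>R (\<tau> (t + h) p - \<tau> t p)) \<longlongrightarrow> gen (\<tau> t p)) (at_right 0)"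
proof -
  have "((\<lambda>h. (1 / h) *\<^sub>R (\<tau> h (\<tau> t p) - \<tau> t p)) \<longlongrightarrow> gen (\<tau> t p)) (at_right 0)"
    using generator \<tau>_p_in[OF assms] by (simp add: generator_on_def)
  moreover have "eventually (\<lambda>h. (1 / h) *\<^sub>R (\<tau> h (\<tau> t p) - \<tau> t p)
      = (1 / h) *\<^sub>R (\<tau> (t + h) p - \<tau> t p)) (at_right 0)"
    unfolding eventually_at_filter
    by (rule always_eventually) (use assms p_in in \<open>auto simp: \<tau>_add add.commute[of t]\<close>)
  ultimately show ?thesis by (rule Lim_transform_eventually)
qed

definition form :: "'h \<Rightarrow> real \<Rightarrow> real" where
  "form u t = Re (cinner u (blinfun_apply (\<tau> t p) u))"

lemma form_nonneg: "t \<ge> 0 \<Longrightarrow> 0 \<le> form u t"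
  unfolding form_def by (rule positive_op_Re[OF \<tau>_p_positive])

lemma form_eq_0_iff: "t \<ge> 0 \<Longrightarrow> form u t = 0 \<longleftrightarrow> blinfun_apply (\<tau> t p) u = 0"
  unfolding form_def using positive_op_kernel[OF \<tau>_p_positive] by auto

text \<open>
  The increment of \<open>\<tau>\<close> over a time interval of length \<open>h\<close> starting at \<open>s\<close> is the image under the
  positive unital map \<open>\<tau> s\<close> of \<open>\<tau> h p - p\<close>, which lies between \<open>0\<close> and its norm.
\<close>

lemma form_increment:
  assumes s: "s \<ge> 0" and h: "h \<ge> 0"
  shows "form u s \<le> form u (s + h)"
    and "form u (s + h) - form u s \<le> norm (\<tau> h p - p) * (norm u)\<^sup>2"
proof -
  define d where "d = \<tau> h p - p"
  have d_in: "d \<in> M" unfolding d_def by (rule von_neumann_algebra_closed(3)[OF vN \<tau>_p_in[OF h] p_in])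
  have d_pos: "positive_op d" unfolding d_def by (rule p_le[OF h])
  have e_in: "norm d *\<^sub>R id_blinfun \<in> M" by (rule von_neumann_algebra_closed(2)[OF vN id_in])
  have inc: "form u (s + h) - form u s = Re (cinner u (blinfun_apply (\<tau> s d) u))"
    unfolding form_def d_def
    by (simp add: \<tau>_add[OF s h p_in] linear_map_on_real(2)[OF vN \<tau>_lin[OF s] \<tau>_p_in[OF h] p_in]
        blinfun.diff_left cinner.diff_right)
  show "form u s \<le> form u (s + h)"
    using inc positive_op_Re[OF \<tau>_positive[OF s d_in d_pos], of u] by simp
  have "positive_op (norm d *\<^sub>R id_blinfun - d)"
  proof -
    have "norm d *\<^sub>R id_blinfun - d \<in> bounded_ops"
      using von_neumann_algebra_closed(3)[OF vN e_in d_in] M_bounded by blast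
    moreover have "cinner v (blinfun_apply (norm d *\<^sub>R id_blinfun - d) v) \<in> \<real>\<^sub>\<ge>\<^sub>0" for v
      using d_pos Re_form_le_norm[of v d]
      by (auto simp: positive_op_def complex_nonneg_Reals_iff blinfun.diff_left blinfun.scaleR_left
          cinner.diff_right cinner_scaleR_right cinner_self power2_eq_square)
    ultimately show ?thesis by (simp add: positive_op_def)
  qed
  then have "positive_op (\<tau> s (norm d *\<^sub>R id_blinfun - d))"
    by (intro \<tau>_positive s von_neumann_algebra_closed(3)[OF vN] e_in d_in)
  also have "\<tau> s (norm d *\<^sub>R id_blinfun - d) = norm d *\<^sub>R id_blinfun - \<tau> s d"
    by (simp add: linear_map_on_real[OF vN \<tau>_lin[OF s]] id_in d_in e_in \<tau>_id[OF s])
  finally show "form u (s + h) - form u s \<le> norm (\<tau> h p - p) * (norm u)\<^sup>2"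
    using positive_op_Re[of "norm d *\<^sub>R id_blinfun - \<tau> s d" u] inc
    by (simp add: blinfun.diff_left blinfun.scaleR_left cinner.diff_right cinner_scaleR_right
        Re_cinner_self d_def)
qed

lemma form_mono: "0 \<le> s \<Longrightarrow> s \<le> t \<Longrightarrow> form u s \<le> form u t"
  using form_increment(1)[of s "t - s" u] by simp

lemma form_continuous: "continuous_on {0..} (form u)"
proof -
  have "((\<lambda>h. h *\<^sub>R ((1 / h) *\<^sub>R (\<tau> (0 + h) p - \<tau> 0 p))) \<longlongrightarrow> 0 *\<^sub>R gen (\<tau> 0 p)) (at_right 0)"
    by (intro tendsto_scaleR \<tau>_right_derivative tendsto_ident_at) simp
  moreover have "eventually (\<lambda>h. h *\<^sub>R ((1 / h) *\<^sub>R (\<tau> (0 + h) p - \<tau> 0 p)) = \<tau> h p - p)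
      (at_right (0::real))"
    unfolding eventually_at_filter
    by (rule always_eventually) (simp add: \<tau>_0[OF p_in])
  ultimately have "((\<lambda>h. \<tau> h p - p) \<longlongrightarrow> 0) (at_right 0)"
    using Lim_transform_eventually by fastforce
  then have lim: "((\<lambda>h. norm (\<tau> h p - p) * (norm u)\<^sup>2) \<longlongrightarrow> 0) (at_right 0)"
    by (intro tendsto_mult_left_zero tendsto_norm_zero)
  show ?thesis
    unfolding continuous_on_iff
  proof (intro ballI allI impI)
    fix t e :: real assume t: "t \<in> {0..}" and e: "e > 0"
    obtain d where d: "d > 0" "\<And>h. 0 < h \<Longrightarrow> h < d \<Longrightarrow> norm (\<tau> h p - p) * (norm u)\<^sup>2 < e"
      using order_tendstoD(2)[OF lim e] by (auto simp: eventually_at_right[of 0 1])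
    have *: "\<bar>form u b - form u a\<bar> < e" if "0 \<le> a" "a \<le> b" "b - a < d" for a b
    proof (cases "a = b")
      case False
      then show ?thesis
        using form_increment[of a "b - a" u] d(2)[of "b - a"] that by simp
    qed (use e in simp)
    show "\<exists>d>0. \<forall>s\<in>{0..}. dist s t < d \<longrightarrow> dist (form u s) (form u t) < e"
    proof (intro exI[of _ d] conjI ballI impI d(1))
      fix s assume "s \<in> {0..}" "dist s t < d"
      then show "dist (form u s) (form u t) < e"
        using *[of s t] *[of t s] t by (cases "s \<le> t") (auto simp: dist_real_def)
    qed
  qed
qed

lemma form_right_derivative:
  assumes "t \<ge> 0"
  shows "((\<lambda>h. (form u (t + h) - form u t) / h)
    \<longlongrightarrow> Re (cinner u (blinfun_apply (gen (\<tau> t p)) u))) (at_right 0)"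
proof -
  have "((\<lambda>h. Re (cinner u (blinfun_apply ((1 / h) *\<^sub>R (\<tau> (t + h) p - \<tau> t p)) u)))
    \<longlongrightarrow> Re (cinner u (blinfun_apply (gen (\<tau> t p)) u))) (at_right 0)"
    by (intro tendsto_Re cinner.tendsto blinfun.tendsto tendsto_const \<tau>_right_derivative assms)
  then show ?thesis
    by (simp add: form_def blinfun.scaleR_left blinfun.diff_left cinner_scaleR_right cinner.diff_right)
qed


section \<open>The common kernel of the orbit\<close>

text \<open>
  If \<open>\<tau> t p\<close> kills \<open>u\<close> for all \<open>t\<close>, then so does its derivative \<open>gen (\<tau> t p)\<close>. In the form of the
  latter only \<open>\<Sum>k. \<langle>L\<^sub>k u, \<tau> t p L\<^sub>k u\<rangle>\<close> is left, so all these nonnegative terms vanish, and then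
  \<open>gen (\<tau> t p) u\<close> reduces to \<open>\<tau> t p (L 0 u)\<close>.
\<close>

lemma orbit_kernel_invariant:
  assumes u: "\<And>t. t \<ge> 0 \<Longrightarrow> blinfun_apply (\<tau> t p) u = 0" and t: "t \<ge> 0"
  shows "blinfun_apply (\<tau> t p) (blinfun_apply (L i) u) = 0"
proof -
  let ?x = "\<tau> t p"
  note pos = \<tau>_p_positive[OF t]
  have "((\<lambda>h. blinfun_apply ((1 / h) *\<^sub>R (\<tau> (t + h) p - ?x)) u)
      \<longlongrightarrow> blinfun_apply (gen ?x) u) (at_right 0)"
    by (intro blinfun.tendsto tendsto_const \<tau>_right_derivative t)
  moreover have "eventually (\<lambda>h. blinfun_apply ((1 / h) *\<^sub>R (\<tau> (t + h) p - ?x)) u = 0) (at_right 0)"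
    unfolding eventually_at_filter
    by (rule always_eventually) (use t in \<open>auto simp: blinfun.scaleR_left blinfun.diff_left u\<close>)
  ultimately have "((\<lambda>h::real. 0) \<longlongrightarrow> blinfun_apply (gen ?x) u) (at_right 0)"
    by (rule Lim_transform_eventually)
  then have gen0: "blinfun_apply (gen ?x) u = 0"
    using tendsto_unique[OF trivial_limit_at_right_real _ tendsto_const] by blast
  have "Re (cinner u (blinfun_apply ?x (blinfun_apply (L 0) u))) = 0"
    by (subst positive_op_Re_sym[OF pos]) (simp add: u[OF t])
  then have "Re (cinner u (blinfun_apply (\<Phi> ?x) u)) = 0"
    using form_gen[of u ?x] unfolding gen0 by (simp add: u[OF t])
  then have "(\<lambda>k. Re (cinner (blinfun_apply (L (Suc k)) u)
      (blinfun_apply ?x (blinfun_apply (L (Suc k)) u)))) sums 0"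
    using form_sums[OF \<tau>_p_in[OF t], of u] by simp
  then have "Re (cinner (blinfun_apply (L (Suc k)) u)
      (blinfun_apply ?x (blinfun_apply (L (Suc k)) u))) = 0" for k
    using suminf_eq_zero_iff[of "\<lambda>k. Re (cinner (blinfun_apply (L (Suc k)) u)
      (blinfun_apply ?x (blinfun_apply (L (Suc k)) u)))"] positive_op_Re[OF pos]
    by (simp add: sums_iff)
  then have Suc: "blinfun_apply ?x (blinfun_apply (L (Suc k)) u) = 0" for k
    by (rule positive_op_kernel[OF pos])
  have "(\<lambda>n. blinfun_apply (\<Sum>k<n. adj (L (Suc k)) o\<^sub>L ?x o\<^sub>L L (Suc k)) u)
      \<longlonglongrightarrow> blinfun_apply (\<Phi> ?x) u"
    using \<Phi>_sums[OF \<tau>_p_in[OF t]] by (simp add: sot_sums_def sot_tendsto_def)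
  then have "blinfun_apply (\<Phi> ?x) u = 0"
    by (simp add: blinfun.sum_left Suc LIMSEQ_const_iff)
  then have "blinfun_apply ?x (blinfun_apply (L 0) u) = 0"
    using gen0 by (simp add: blinfun.add_left u[OF t])
  then show ?thesis using Suc by (cases i) auto
qed

text \<open>
  The Lindblad form preserves bounds on a set of vectors that is invariant under all \<open>L k\<close>. The
  mixed terms are bounded by positivity at \<open>u - L 0 u\<close>, and the sum by comparison with
  \<open>\<Phi> id_blinfun\<close>.
\<close>

lemma form_gen_le:
  assumes x: "x \<in> M" "positive_op x"
    and V: "\<And>u k. u \<in> V \<Longrightarrow> blinfun_apply (L k) u \<in> V"
    and B: "\<And>u. u \<in> V \<Longrightarrow> Re (cinner u (blinfun_apply x u)) \<le> B * (norm u)\<^sup>2" "0 \<le> B"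
    and u: "u \<in> V"
  shows "Re (cinner u (blinfun_apply (gen x) u))
    \<le> (1 + (norm (L 0))\<^sup>2 + norm (\<Phi> id_blinfun)) * (B * (norm u)\<^sup>2)"
proof -
  let ?q = "\<lambda>v. Re (cinner v (blinfun_apply x v))"
  let ?w = "blinfun_apply (L 0) u"
  have "Re (cinner ?w (blinfun_apply x u)) + Re (cinner u (blinfun_apply x ?w)) \<le> ?q u + ?q ?w"
    using positive_op_Re[OF x(2), of "u + (-1) *\<^sub>R ?w"] positive_op_form_add[OF x(2), of u "-1" ?w]
      positive_op_Re_sym[OF x(2), of u ?w]
    by simp
  moreover have "?q u \<le> B * (norm u)\<^sup>2"
    by (rule B(1)[OF u])
  moreover have "?q ?w \<le> (norm (L 0))\<^sup>2 * (B * (norm u)\<^sup>2)"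
  proof -
    have "?q ?w \<le> B * (norm ?w)\<^sup>2" by (rule B(1)[OF V[OF u]])
    also have "\<dots> \<le> B * (norm (L 0) * norm u)\<^sup>2"
      by (intro mult_left_mono power_mono norm_blinfun B) simp
    finally show ?thesis by (simp add: power_mult_distrib ac_simps)
  qed
  moreover have "Re (cinner u (blinfun_apply (\<Phi> x) u)) \<le> norm (\<Phi> id_blinfun) * (B * (norm u)\<^sup>2)"
  proof -
    have "(\<lambda>k. B * (norm (blinfun_apply (L (Suc k)) u))\<^sup>2)
        sums (B * Re (cinner u (blinfun_apply (\<Phi> id_blinfun) u)))"
      using sums_mult[OF form_sums[OF id_in, of u], of B] by (simp add: Re_cinner_self)
    then have "Re (cinner u (blinfun_apply (\<Phi> x) u))
        \<le> B * Re (cinner u (blinfun_apply (\<Phi> id_blinfun) u))"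
      by (rule sums_le[rotated 2, OF _ ]) (use form_sums[OF x(1), of u] B(1)[OF V[OF u]] in auto)
    also have "\<dots> \<le> B * (norm (\<Phi> id_blinfun) * (norm u)\<^sup>2)"
      by (intro mult_left_mono Re_form_le_norm B)
    finally show ?thesis by (simp add: ac_simps)
  qed
  ultimately show ?thesis
    unfolding form_gen by (simp add: algebra_simps)
qed

text \<open>
  Any bound \<open>B\<close> for the forms on \<open>V\<close> over an interval of length \<open>d\<close> improves to \<open>C d B\<close>, with the
  constant \<open>C\<close> of the preceding estimate, provided that they vanish at its left end. Hence they
  vanish throughout a short interval, and since \<open>d\<close> does not depend on that end, for all times.
\<close>

lemma form_vanishes:
  assumes V: "\<And>u k. u \<in> V \<Longrightarrow> blinfun_apply (L k) u \<in> V"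
    and p0: "\<And>u. u \<in> V \<Longrightarrow> blinfun_apply p u = 0"
    and u: "u \<in> V" and t: "t \<ge> 0"
  shows "form u t = 0"
proof -
  define C where "C = 1 + (norm (L 0))\<^sup>2 + norm (\<Phi> id_blinfun)"
  have C: "C > 0" unfolding C_def by (simp add: add_pos_nonneg)
  define d where "d = 1 / (2 * C)"
  have d: "d > 0" and Cd: "C * d = 1 / 2" using C by (auto simp: d_def)
  have step: "form u (a + d) = 0" if a: "a \<ge> 0" "\<And>u. u \<in> V \<Longrightarrow> form u a = 0" and u: "u \<in> V" for a u
  proof -
    define B0 where "B0 = norm (\<tau> (a + d) p)"
    \<comment> \<open>The choice \<open>C * d = 1 / 2\<close> halves the bound in each round.\<close>
    have bound: "form u (a + d) \<le> (B0 / 2 ^ n) * (norm u)\<^sup>2" if "u \<in> V" for n u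
      using that
    proof (induction n arbitrary: u)
      case 0
      show ?case unfolding form_def B0_def using Re_form_le_norm by simp
    next
      case (Suc n)
      let ?B = "B0 / 2 ^ n"
      have "form u (a + d) - form u a \<le> C * (?B * (norm u)\<^sup>2) * (a + d - a)"
      proof (rule right_derivative_bound)
        show "continuous_on {a..a + d} (form u)"
          using form_continuous by (rule continuous_on_subset) (use a in auto)
        fix s assume s: "a \<le> s" "s < a + d"
        then have s0: "s \<ge> 0" using a by simp
        show "((\<lambda>h. (form u (s + h) - form u s) / h)
            \<longlongrightarrow> Re (cinner u (blinfun_apply (gen (\<tau> s p)) u))) (at_right 0)"
          by (rule form_right_derivative[OF s0])
        show "Re (cinner u (blinfun_apply (gen (\<tau> s p)) u)) \<le> C * (?B * (norm u)\<^sup>2)"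
          unfolding C_def
        proof (rule form_gen_le[OF \<tau>_p_in[OF s0] \<tau>_p_positive[OF s0] V _ _ Suc.prems])
          fix v assume v: "v \<in> V"
          have "form v s \<le> form v (a + d)" using form_mono[OF s0, of "a + d" v] s by simp
          also have "\<dots> \<le> ?B * (norm v)\<^sup>2" by (rule Suc.IH[OF v])
          finally show "Re (cinner v (blinfun_apply (\<tau> s p) v)) \<le> ?B * (norm v)\<^sup>2"
            by (simp add: form_def)
        qed (simp_all add: B0_def)
      qed (use d in simp)
      also have "\<dots> = (C * d) * (?B * (norm u)\<^sup>2)" by simp
      finally show ?case using a(2)[OF Suc.prems] by (simp add: Cd)
    qed
    have "(\<lambda>n. B0 * (norm u)\<^sup>2 * (1 / 2) ^ n) \<longlonglongrightarrow> B0 * (norm u)\<^sup>2 * 0"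
      by (intro tendsto_intros LIMSEQ_realpow_zero) auto
    then have "form u (a + d) \<le> B0 * (norm u)\<^sup>2 * 0"
      by (rule LIMSEQ_le_const) (use bound[OF u] in \<open>auto simp: power_divide\<close>)
    then show ?thesis using form_nonneg[of "a + d" u] a d by simp
  qed
  have steps: "form u (real n * d) = 0" if "u \<in> V" for n u
    using that
  proof (induction n arbitrary: u)
    case 0
    then show ?case by (simp add: form_def \<tau>_0[OF p_in] p0)
  next
    case (Suc n)
    then show ?case using step[of "real n * d" u] d by (simp add: algebra_simps)
  qed
  obtain n where "t / d \<le> real n" using real_arch_simple by blast
  then have "t \<le> real n * d" using d by (simp add: field_simps)
  then have "form u t \<le> 0" using form_mono[OF t, of "real n * d" u] steps[OF u, of n] by simp
  then show ?thesis using form_nonneg[OF t, of u] by simp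
qed

lemma op_word_Cons: "blinfun_apply (op_word K (i # ws)) u = blinfun_apply (K i) (blinfun_apply (op_word K ws) u)"
  by (simp add: op_word_def)

lemma op_word_snoc: "blinfun_apply (op_word K (ws @ [i])) u = blinfun_apply (op_word K ws) (blinfun_apply (K i) u)"
  by (induction ws) (simp_all add: op_word_def)

text \<open>
  The set of all \<open>u\<close> as on the right is invariant under all \<open>L k\<close> and contained in the kernel of
  \<open>p\<close>, so \<open>form_vanishes\<close> applies to it. Conversely, invariance carries a vector \<open>u\<close> as on the left
  to all \<open>op_word L ws u\<close>, and time \<open>0\<close> gives \<open>p\<close>.
\<close>

lemma orbit_kernel_iff_words:
  "(\<forall>t\<ge>0. blinfun_apply (\<tau> t p) u = 0) \<longleftrightarrow> (\<forall>ws. blinfun_apply p (blinfun_apply (op_word L ws) u) = 0)"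
proof (intro iffI allI impI)
  fix ws :: "nat list"
  assume u: "\<forall>t\<ge>0. blinfun_apply (\<tau> t p) u = 0"
  have "\<forall>t\<ge>0. blinfun_apply (\<tau> t p) (blinfun_apply (op_word L ws) u) = 0"
  proof (induction ws)
    case Nil
    then show ?case using u by (simp add: op_word_def)
  next
    case (Cons i ws)
    then show ?case using orbit_kernel_invariant by (simp add: op_word_Cons)
  qed
  from this[rule_format, of 0] show "blinfun_apply p (blinfun_apply (op_word L ws) u) = 0"
    by (simp add: \<tau>_0[OF p_in])
next
  fix t :: real
  assume u: "\<forall>ws. blinfun_apply p (blinfun_apply (op_word L ws) u) = 0" and t: "t \<ge> 0"
  define V where "V = {u. \<forall>ws. blinfun_apply p (blinfun_apply (op_word L ws) u) = 0}"
  have "form u t = 0"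
  proof (rule form_vanishes[of V])
    show "blinfun_apply (L k) v \<in> V" if "v \<in> V" for v k
      using that by (auto simp: V_def simp flip: op_word_snoc)
    show "blinfun_apply p v = 0" if "v \<in> V" for v
      using that by (auto simp: V_def op_word_def dest: spec[of _ "[]"])
  qed (use u t in \<open>auto simp: V_def\<close>)
  then show "blinfun_apply (\<tau> t p) u = 0" by (simp add: form_eq_0_iff[OF t])
qed

text \<open>By monotonicity the forms of the orbit are bounded by that of the limit.\<close>

lemma limit_kernel_iff_orbit_kernel:
  assumes y: "sot_tendsto (\<lambda>t. \<tau> t p) y at_top"
  shows "blinfun_apply y u = 0 \<longleftrightarrow> (\<forall>t\<ge>0. blinfun_apply (\<tau> t p) u = 0)"
proof
  have lim: "((\<lambda>t. blinfun_apply (\<tau> t p) u) \<longlongrightarrow> blinfun_apply y u) at_top"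
    using y by (simp add: sot_tendsto_def)
  {
    assume "blinfun_apply y u = 0"
    then have lim0: "(form u \<longlongrightarrow> 0) at_top"
      using tendsto_Re[OF cinner.tendsto[OF tendsto_const lim, of u]] by (simp add: form_def[abs_def])
    show "\<forall>t\<ge>0. blinfun_apply (\<tau> t p) u = 0"
    proof (intro allI impI)
      fix t :: real assume t: "t \<ge> 0"
      have "form u t \<le> 0"
        using lim0 by (rule tendsto_lowerbound)
          (auto intro!: eventually_mono[OF eventually_ge_at_top[of t]] form_mono[OF t])
      then show "blinfun_apply (\<tau> t p) u = 0"
        using form_nonneg[OF t, of u] form_eq_0_iff[OF t, of u] by simp
    qed
  }
  assume "\<forall>t\<ge>0. blinfun_apply (\<tau> t p) u = 0"
  then have "eventually (\<lambda>t. blinfun_apply (\<tau> t p) u = 0) at_top"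
    by (auto intro: eventually_mono[OF eventually_ge_at_top[of 0]])
  with lim have "((\<lambda>t::real. 0) \<longlongrightarrow> blinfun_apply y u) at_top"
    by (rule Lim_transform_eventually)
  then show "blinfun_apply y u = 0"
    using tendsto_unique[OF trivial_limit_at_top_linorder _ tendsto_const] by blast
qed

end

lemma sot_sums_suminf: "sot_summable T \<Longrightarrow> sot_sums T (sot_suminf T)"
  unfolding sot_summable_def sot_suminf_def
  by (rule theI', erule ex_ex1I)
    (auto simp: sot_sums_def sot_tendsto_def intro!: blinfun_eqI intro: LIMSEQ_unique)

theorem proposition4p2:
  fixes A\<^sub>0 :: "'h::complex_hilbert op set"
    and \<tau> :: "real \<Rightarrow> 'h op \<Rightarrow> 'h op"
    and L :: "nat \<Rightarrow> 'h op"
    and Y p y z :: "'h op"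
  assumes separable: "separable_space (euclidean :: 'h topology)"
    and vN: "von_neumann_algebra A\<^sub>0"
    and markov: "norm_continuous_markov_semigroup A\<^sub>0 \<tau>"
    and Y_in: "Y \<in> A\<^sub>0"
    and Y_generator: "\<exists>S. norm_continuous_contraction_semigroup S \<and>
           generator_on UNIV (\<lambda>t. blinfun_apply (S t)) (blinfun_apply Y)"
    and L_bounded: "\<forall>k\<ge>1. L k \<in> bounded_ops"
    and L_sum: "\<forall>x\<in>A\<^sub>0. sot_summable (\<lambda>k. adj (L (Suc k)) o\<^sub>L x o\<^sub>L L (Suc k)) \<and>
           sot_suminf (\<lambda>k. adj (L (Suc k)) o\<^sub>L x o\<^sub>L L (Suc k)) \<in> A\<^sub>0"
    and generator: "generator_on A\<^sub>0 \<tau>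
           (\<lambda>x. (adj Y o\<^sub>L x) + (x o\<^sub>L Y)
                + sot_suminf (\<lambda>k. adj (L (Suc k)) o\<^sub>L x o\<^sub>L L (Suc k)))"
    and L_zero: "L 0 = Y"
    and p: "subharmonic_projection A\<^sub>0 \<tau> p"
    and y: "sot_tendsto (\<lambda>t. \<tau> t p) y at_top"
    and z: "z \<in> bounded_ops"
  shows "y o\<^sub>L z = 0 \<longleftrightarrow>
           p o\<^sub>L z = 0 \<and> (\<forall>is. length is \<ge> 1 \<longrightarrow> p o\<^sub>L op_word L is o\<^sub>L z = 0)"
proof -
  \<comment> \<open>The condition on \<open>p o\<^sub>L z\<close> is the one for the empty word.\<close>
  have word_split: "(p o\<^sub>L z = 0 \<and> (\<forall>is. length is \<ge> 1 \<longrightarrow> p o\<^sub>L op_word L is o\<^sub>L z = 0))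
      \<longleftrightarrow> (\<forall>is. p o\<^sub>L op_word L is o\<^sub>L z = 0)"
  proof -
    have "op_word L [] = id_blinfun" by (simp add: op_word_def)
    then have "p o\<^sub>L z = p o\<^sub>L op_word L [] o\<^sub>L z" by (simp add: blinfun_eqI)
    moreover have "length is \<ge> 1 \<or> is = []" for "is" :: "nat list" by (cases "is") auto
    ultimately show ?thesis by metis
  qed
  define \<Phi> where "\<Phi> x = sot_suminf (\<lambda>k. adj (L (Suc k)) o\<^sub>L x o\<^sub>L L (Suc k))" for x
  interpret lindblad_semigroup A\<^sub>0 \<tau> L \<Phi> p
  proof
    show "L k \<in> bounded_ops" for k
      using L_bounded L_zero Y_in vN by (cases k) (auto simp: von_neumann_algebra_def)
    show "sot_sums (\<lambda>k. adj (L (Suc k)) o\<^sub>L x o\<^sub>L L (Suc k)) (\<Phi> x)" if "x \<in> A\<^sub>0" for x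
      using L_sum that unfolding \<Phi>_def by (blast intro: sot_sums_suminf)
    show "generator_on A\<^sub>0 \<tau> (\<lambda>x. (adj (L 0) o\<^sub>L x) + (x o\<^sub>L L 0) + \<Phi> x)"
      using generator by (simp add: \<Phi>_def L_zero)
  qed (fact vN markov p)+
  have eq_0: "A = 0 \<longleftrightarrow> (\<forall>v. blinfun_apply A v = 0)" for A :: "'h op"
    by (auto intro: blinfun_eqI)
  show ?thesis
    unfolding word_split
    by (auto simp: eq_0 limit_kernel_iff_orbit_kernel[OF y] orbit_kernel_iff_words)
qed

end
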